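(* Let $n\in\{x,y,z\}$ and let $V$ be a finite-dimensional irreducible $\mathcal{A}$-module of type $AB(d,n)$. Then for each of $x,y,z$ the action on $V$ is diagonalizable. For $a\in\{x,y,z\}$, the eigenvalues of $a$ on $V$ are $(-1)^{d+i}(2d-2i+1)$ for $0\le i\le d$ if $a=n$, and $(-1)^{d+i+1}(2d-2i+1)$ for $0\le i\le d$ if $a\neq n$.
   Context: $\mathbb{K}$ is an algebraically closed field of characteristic zero. $\mathcal{A}$ is the unital associative $\mathbb{K}$-algebra with generators $x,y,z$ and relations $xy+yx=2z$, $yz+zy=2x$, $zx+xz=2y$. Type $AB(d,n)$ ($d\ge 0$ an integer, $n\in\{x,y,z\}$ regarded as a symbol): for $a\in\{x,y,z\}$ put $\widehat a(n)=1$ if $n=a$ and $\widehat a(n)=-1$ otherwise. An $\mathcal{A}$-module is of type $AB(d,n)$ if it is isomorphic to the irreducible module with basis $\{v_i\}_{i=0}^d$ and, for $0\le i\le d$: $x.v_i=\widehat x(n)(-1)^{d+i}(2d-2i+1)v_i$, $y.v_i=\widehat y(n)(-1)^d\big((2d-i+2)v_{i-1}+(i+1)v_{i+1}\big)$, $z.v_i=\widehat z(n)\big((-1)^{i-1}(2d-i+2)v_{i-1}+(-1)^i(i+1)v_{i+1}\big)$, with $v_{-1}=0$, $v_{d+1}=v_d$. *)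

theory Defs
  imports "HOL-Library.Poly_Mapping" "HOL-Computational_Algebra.Polynomial"
begin

section \<open>The algebra \<open>\<A>\<close>\<close>

datatype gen = GenX | GenY | GenZ

text \<open>
  Words in the generators form the free monoid, written additively so that \<open>gen_word \<Rightarrow>\<^sub>0 'k\<close> with the
  convolution product is the free associative unital \<open>'k\<close>-algebra on the generators.
\<close>

datatype gen_word = Word "gen list"

instantiation gen_word :: monoid_add
begin

definition zero_gen_word :: gen_word
  where "zero_gen_word = Word []"

fun plus_gen_word :: "gen_word \<Rightarrow> gen_word \<Rightarrow> gen_word"
  where "plus_gen_word (Word u) (Word v) = Word (u @ v)"

instance
proof
  fix a b c :: gen_word
  show "a + b + c = a + (b + c)" by (cases a; cases b; cases c) simp
  show "0 + a = a" by (cases a) (simp add: zero_gen_word_def)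
  show "a + 0 = a" by (cases a) (simp add: zero_gen_word_def)
qed

end

definition free_gen :: "gen \<Rightarrow> gen_word \<Rightarrow>\<^sub>0 'k::field"
  where "free_gen a = Poly_Mapping.single (Word [a]) 1"

definition relators :: "(gen_word \<Rightarrow>\<^sub>0 'k::field) set"
  where "relators =
    {free_gen GenX * free_gen GenY + free_gen GenY * free_gen GenX - 2 * free_gen GenZ,
     free_gen GenY * free_gen GenZ + free_gen GenZ * free_gen GenY - 2 * free_gen GenX,
     free_gen GenZ * free_gen GenX + free_gen GenX * free_gen GenZ - 2 * free_gen GenY}"

text \<open>
  The two-sided ideal generated by the relators. Closure under negation follows from the
  second rule.
\<close>

inductive_set rel_ideal :: "(gen_word \<Rightarrow>\<^sub>0 'k::field) set"
  where
    zero: "0 \<in> rel_ideal"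
  | relator: "r \<in> relators \<Longrightarrow> p * r * q \<in> rel_ideal"
  | add: "a \<in> rel_ideal \<Longrightarrow> b \<in> rel_ideal \<Longrightarrow> a + b \<in> rel_ideal"

lemma rel_ideal_mult_left: "a \<in> rel_ideal \<Longrightarrow> p * a \<in> rel_ideal"
proof (induction rule: rel_ideal.induct)
  case (relator r p' q)
  then show ?case
    using rel_ideal.relator[of r "p * p'" q] by (simp add: mult.assoc)
qed (auto simp: distrib_left intro: rel_ideal.intros)

lemma rel_ideal_mult_right: "a \<in> rel_ideal \<Longrightarrow> a * p \<in> rel_ideal"
proof (induction rule: rel_ideal.induct)
  case (relator r p' q)
  then show ?case
    using rel_ideal.relator[of r p' "q * p"] by (simp add: mult.assoc)
qed (auto simp: distrib_right intro: rel_ideal.intros)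

lemma rel_ideal_uminus: "a \<in> rel_ideal \<Longrightarrow> - a \<in> rel_ideal"
  using rel_ideal_mult_left[of a "- 1"] by simp

lemma rel_ideal_diff: "a \<in> rel_ideal \<Longrightarrow> b \<in> rel_ideal \<Longrightarrow> a - b \<in> rel_ideal"
  using rel_ideal.add[of a "- b"] rel_ideal_uminus[of b] by simp

text \<open>
  The ideal is proper: it is contained in the kernel of the algebra homomorphism to the ground
  field that sends every generator to 1.
\<close>

definition coeff_sum :: "(gen_word \<Rightarrow>\<^sub>0 'k::field) \<Rightarrow> 'k"
  where "coeff_sum p = (\<Sum>w\<in>Poly_Mapping.keys p. Poly_Mapping.lookup p w)"

lemma coeff_sum_superset:
  "finite S \<Longrightarrow> Poly_Mapping.keys p \<subseteq> S \<Longrightarrow> coeff_sum p = (\<Sum>w\<in>S. Poly_Mapping.lookup p w)"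
  unfolding coeff_sum_def by (rule sum.mono_neutral_left) (auto simp: in_keys_iff)

lemma coeff_sum_add: "coeff_sum (p + q) = coeff_sum p + coeff_sum q"
proof -
  let ?S = "Poly_Mapping.keys p \<union> Poly_Mapping.keys q"
  have "Poly_Mapping.keys (p + q) \<subseteq> ?S" by (rule keys_add)
  then show ?thesis
    by (simp add: coeff_sum_superset[of ?S] lookup_add sum.distrib)
qed

lemma coeff_sum_zero [simp]: "coeff_sum 0 = 0"
  by (simp add: coeff_sum_def)

lemma coeff_sum_single [simp]: "coeff_sum (Poly_Mapping.single w c) = c"
  by (simp add: coeff_sum_def)

lemma free_alg_induct [case_names zero add]:
  fixes p :: "gen_word \<Rightarrow>\<^sub>0 'k::field"
  assumes "P 0" and step: "\<And>p w c. P p \<Longrightarrow> P (p + Poly_Mapping.single w c)"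
  shows "P p"
proof (induction p rule: update_induct)
  case const
  show ?case by (rule assms)
next
  case (update p w c)
  then have "Poly_Mapping.update w c p = p + Poly_Mapping.single w c"
    by (intro poly_mapping_eqI)
      (auto simp: lookup_update lookup_add lookup_single in_keys_iff when_def)
  with step update.IH show ?case by simp
qed

lemma coeff_sum_mult: "coeff_sum (p * q) = coeff_sum p * coeff_sum q"
proof (induction p rule: free_alg_induct)
  case (add p w c)
  have "coeff_sum (Poly_Mapping.single w c * q) = c * coeff_sum q"
    by (induction q rule: free_alg_induct)
      (simp_all add: distrib_left coeff_sum_add mult_single)
  with add show ?case by (simp add: distrib_right coeff_sum_add)
qed simp

lemma coeff_sum_rel_ideal: "a \<in> rel_ideal \<Longrightarrow> coeff_sum a = 0"
proof (induction rule: rel_ideal.induct)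
  case (relator r p q)
  have minus: "coeff_sum (a - b) = coeff_sum a - coeff_sum b"
    for a b :: "gen_word \<Rightarrow>\<^sub>0 'a"
    using coeff_sum_add[of "a - b" b] by simp
  have one: "coeff_sum (1 :: gen_word \<Rightarrow>\<^sub>0 'a) = 1"
    using coeff_sum_single[of 0 "1 :: 'a"] by simp
  have two: "coeff_sum (2 :: gen_word \<Rightarrow>\<^sub>0 'a) = 2"
    using coeff_sum_add[of "1 :: gen_word \<Rightarrow>\<^sub>0 'a" 1] one by (simp add: one_add_one)
  from relator have "coeff_sum r = 0"
    by (auto simp: relators_def free_gen_def coeff_sum_add minus coeff_sum_mult two)
  then show ?case by (simp add: coeff_sum_mult)
qed (simp_all add: coeff_sum_add)

quotient_type (overloaded) 'k alg_A =
  "gen_word \<Rightarrow>\<^sub>0 'k::field" / "\<lambda>p q. p - q \<in> rel_ideal"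
proof (rule equivpI)
  show "reflp (\<lambda>p q :: gen_word \<Rightarrow>\<^sub>0 'k. p - q \<in> rel_ideal)"
    by (simp add: reflp_def rel_ideal.zero)
  show "symp (\<lambda>p q :: gen_word \<Rightarrow>\<^sub>0 'k. p - q \<in> rel_ideal)"
    by (metis (mono_tags, lifting) sympI minus_diff_eq rel_ideal_uminus)
  show "transp (\<lambda>p q :: gen_word \<Rightarrow>\<^sub>0 'k. p - q \<in> rel_ideal)"
  proof (rule transpI)
    fix p q r :: "gen_word \<Rightarrow>\<^sub>0 'k"
    assume "p - q \<in> rel_ideal" "q - r \<in> rel_ideal"
    from rel_ideal.add[OF this] show "p - r \<in> rel_ideal" by simp
  qed
qed

instantiation alg_A :: (field) ring_1
begin

lift_definition zero_alg_A :: "'a alg_A" is 0 .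

lift_definition one_alg_A :: "'a alg_A" is 1 .

lift_definition plus_alg_A :: "'a alg_A \<Rightarrow> 'a alg_A \<Rightarrow> 'a alg_A" is "(+)"
  using rel_ideal.add by (fastforce simp: algebra_simps)

lift_definition minus_alg_A :: "'a alg_A \<Rightarrow> 'a alg_A \<Rightarrow> 'a alg_A" is "(-)"
  using rel_ideal_diff by (fastforce simp: algebra_simps)

lift_definition uminus_alg_A :: "'a alg_A \<Rightarrow> 'a alg_A" is uminus
  using rel_ideal_uminus by (fastforce simp: algebra_simps)

lift_definition times_alg_A :: "'a alg_A \<Rightarrow> 'a alg_A \<Rightarrow> 'a alg_A" is "(*)"
proof -
  fix p p' q q' :: "gen_word \<Rightarrow>\<^sub>0 'a"
  assume "p - p' \<in> rel_ideal" "q - q' \<in> rel_ideal"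
  then have "(p - p') * q + p' * (q - q') \<in> rel_ideal"
    by (intro rel_ideal.add rel_ideal_mult_left rel_ideal_mult_right)
  then show "p * q - p' * q' \<in> rel_ideal" by (simp add: algebra_simps)
qed

instance
proof
  show "(0 :: 'a alg_A) \<noteq> 1"
  proof transfer
    have "coeff_sum (0 - 1 :: gen_word \<Rightarrow>\<^sub>0 'a) \<noteq> 0"
      using coeff_sum_add[of "- 1 :: gen_word \<Rightarrow>\<^sub>0 'a" 1] coeff_sum_single[of 0 "1 :: 'a"] by auto
    then show "0 - 1 \<notin> (rel_ideal :: (gen_word \<Rightarrow>\<^sub>0 'a) set)"
      using coeff_sum_rel_ideal by blast
  qed
qed (transfer, simp add: algebra_simps rel_ideal.zero)+

end

lift_definition alg_gen :: "gen \<Rightarrow> 'k::field alg_A" is free_gen .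

lift_definition alg_scalar :: "'k::field \<Rightarrow> 'k alg_A" is "\<lambda>c. Poly_Mapping.single 0 c" .

lemma alg_A_relations:
  "alg_gen GenX * alg_gen GenY + alg_gen GenY * alg_gen GenX = 2 * (alg_gen GenZ :: 'k::field alg_A)"
  "alg_gen GenY * alg_gen GenZ + alg_gen GenZ * alg_gen GenY = 2 * (alg_gen GenX :: 'k::field alg_A)"
  "alg_gen GenZ * alg_gen GenX + alg_gen GenX * alg_gen GenZ = 2 * (alg_gen GenY :: 'k::field alg_A)"
proof -
  have *: "r \<in> rel_ideal" if "r \<in> relators" for r :: "gen_word \<Rightarrow>\<^sub>0 'k"
    using rel_ideal.relator[OF that, of 1 1] by simp
  have two: "(2 :: 'a::ring_1) * a = a + a" for a
    by (simp add: mult_2)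
  show "alg_gen GenX * alg_gen GenY + alg_gen GenY * alg_gen GenX = 2 * (alg_gen GenZ :: 'k alg_A)"
    unfolding two by transfer (rule *, simp add: relators_def two)
  show "alg_gen GenY * alg_gen GenZ + alg_gen GenZ * alg_gen GenY = 2 * (alg_gen GenX :: 'k alg_A)"
    unfolding two by transfer (rule *, simp add: relators_def two)
  show "alg_gen GenZ * alg_gen GenX + alg_gen GenX * alg_gen GenZ = 2 * (alg_gen GenY :: 'k alg_A)"
    unfolding two by transfer (rule *, simp add: relators_def two)
qed

lemma alg_scalar_add: "alg_scalar (c + e) = alg_scalar c + alg_scalar e"
  by transfer (simp add: single_add rel_ideal.zero)

lemma alg_scalar_mult: "alg_scalar (c * e) = alg_scalar c * alg_scalar e"
  by transfer (simp add: mult_single rel_ideal.zero)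

lemma alg_scalar_one: "alg_scalar 1 = 1"
  by transfer (simp add: rel_ideal.zero)

lemma alg_scalar_central: "alg_scalar c * a = a * alg_scalar c"
proof transfer
  fix c :: 'a and p :: "gen_word \<Rightarrow>\<^sub>0 'a"
  have "Poly_Mapping.single 0 c * p = p * Poly_Mapping.single 0 c"
    by (induction p rule: free_alg_induct)
      (simp_all add: distrib_left distrib_right mult_single mult.commute)
  then show "Poly_Mapping.single 0 c * p - p * Poly_Mapping.single 0 c \<in> rel_ideal"
    by (simp add: rel_ideal.zero)
qed

section \<open>Modules\<close>

text \<open>The locale \<^locale>\<open>module\<close> of the library requires commutative scalars.\<close>

locale left_module =
  fixes act :: "'r::ring_1 \<Rightarrow> 'v::ab_group_add \<Rightarrow> 'v"
  assumes act_add_right: "act r (u + v) = act r u + act r v"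
    and act_add_left: "act (r + s) v = act r v + act s v"
    and act_mult: "act (r * s) v = act r (act s v)"
    and act_one: "act 1 v = v"
begin

definition submodule :: "'v set \<Rightarrow> bool"
  where "submodule S \<longleftrightarrow> 0 \<in> S \<and> (\<forall>u\<in>S. \<forall>v\<in>S. u + v \<in> S) \<and> (\<forall>r. \<forall>v\<in>S. act r v \<in> S)"

definition irreducible :: bool
  where "irreducible \<longleftrightarrow> (UNIV :: 'v set) \<noteq> {0} \<and> (\<forall>S. submodule S \<longrightarrow> S = {0} \<or> S = UNIV)"

end

context vector_space
begin

definition eigenvalue :: "('b \<Rightarrow> 'b) \<Rightarrow> 'a \<Rightarrow> bool"
  where "eigenvalue f c \<longleftrightarrow> (\<exists>v. v \<noteq> 0 \<and> f v = scale c v)"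

definition diagonalizable :: "('b \<Rightarrow> 'b) \<Rightarrow> bool"
  where "diagonalizable f \<longleftrightarrow>
    (\<exists>B. independent B \<and> span B = UNIV \<and> (\<forall>b\<in>B. \<exists>c. f b = scale c b))"

end

locale alg_A_module = left_module act
  for act :: "'k::field alg_A \<Rightarrow> 'v::ab_group_add \<Rightarrow> 'v"
begin

definition scal :: "'k \<Rightarrow> 'v \<Rightarrow> 'v"
  where "scal c v = act (alg_scalar c) v"

sublocale vector_space scal
  by unfold_locales
    (simp_all add: scal_def act_add_right act_add_left act_mult act_one
      alg_scalar_add alg_scalar_mult alg_scalar_one)

definition finite_dimensional :: bool
  where "finite_dimensional \<longleftrightarrow> (\<exists>B. finite_dimensional_vector_space scal B)"

end

definition gen_sign :: "gen \<Rightarrow> gen \<Rightarrow> int"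
  where "gen_sign n a = (if n = a then 1 else - 1)"

context alg_A_module
begin

text \<open>
  A module is isomorphic to the module with basis \<open>v\<^sub>0, \<dots>, v\<^sub>d\<close> and the given action of the
  generators iff it has itself such a basis (cf. \<open>AB_basis_module_iso\<close> below). The family is indexed by \<^typ>\<open>int\<close> to accommodate the
  conventions \<open>v\<^sub>-\<^sub>1 = 0\<close> and \<open>v\<^sub>d\<^sub>+\<^sub>1 = v\<^sub>d\<close>. The sign \<open>(-1)\<^bsup>i-1\<^esup>\<close> is written
  \<open>(- 1) ^ (i + 1)\<close>, as subtraction on \<^typ>\<open>nat\<close> truncates.
\<close>

definition AB_basis :: "nat \<Rightarrow> gen \<Rightarrow> (int \<Rightarrow> 'v) \<Rightarrow> bool"
  where "AB_basis d n v \<longleftrightarrow>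
    inj_on v {0..int d} \<and> independent (v ` {0..int d}) \<and> span (v ` {0..int d}) = UNIV \<and>
    v (- 1) = 0 \<and> v (int d + 1) = v (int d) \<and>
    (\<forall>i\<le>d.
      act (alg_gen GenX) (v (int i)) =
        scal (of_int (gen_sign n GenX * (- 1) ^ (d + i) * (2 * int d - 2 * int i + 1))) (v (int i)) \<and>
      act (alg_gen GenY) (v (int i)) =
        scal (of_int (gen_sign n GenY * (- 1) ^ d))
          (scal (of_int (2 * int d - int i + 2)) (v (int i - 1)) +
           scal (of_int (int i + 1)) (v (int i + 1))) \<and>
      act (alg_gen GenZ) (v (int i)) =
        scal (of_int (gen_sign n GenZ))
          (scal (of_int ((- 1) ^ (i + 1) * (2 * int d - int i + 2))) (v (int i - 1)) +
           scal (of_int ((- 1) ^ i * (int i + 1))) (v (int i + 1))))"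

definition type_AB :: "nat \<Rightarrow> gen \<Rightarrow> bool"
  where "type_AB d n \<longleftrightarrow> (\<exists>v. AB_basis d n v)"

end

definition module_iso ::
    "('r::ring_1 \<Rightarrow> 'v::ab_group_add \<Rightarrow> 'v) \<Rightarrow> ('r \<Rightarrow> 'w::ab_group_add \<Rightarrow> 'w) \<Rightarrow> ('v \<Rightarrow> 'w) \<Rightarrow> bool"
  where "module_iso act act' \<phi> \<longleftrightarrow>
    bij \<phi> \<and> (\<forall>u v. \<phi> (u + v) = \<phi> u + \<phi> v) \<and> (\<forall>r v. \<phi> (act r v) = act' r (\<phi> v))"

lemma AB_basis_module_iso:
  assumes A: "alg_A_module act" and A': "alg_A_module act'" and iso: "module_iso act act' \<phi>"
    and AB: "alg_A_module.AB_basis act d n v"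
  shows "alg_A_module.AB_basis act' d n (\<phi> \<circ> v)"
proof -
  interpret M: alg_A_module act by (rule A)
  interpret N: alg_A_module act' by (rule A')
  have bij: "bij \<phi>" and add: "\<phi> (u + w) = \<phi> u + \<phi> w" and hom: "\<phi> (act r u) = act' r (\<phi> u)"
    for u w r
    using iso by (auto simp: module_iso_def)
  have scal: "\<phi> (M.scal c u) = N.scal c (\<phi> u)" for c u
    by (simp add: M.scal_def N.scal_def hom)
  interpret L: Vector_Spaces.linear M.scal N.scal \<phi>
    by unfold_locales (simp_all add: add scal)
  interpret P: vector_space_pair M.scal N.scal ..
  let ?S = "v ` {0..int d}"
  have B: "inj_on v {0..int d}" "M.independent ?S" "M.span ?S = UNIV"
    "v (- 1) = 0" "v (int d + 1) = v (int d)"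
    using AB by (simp_all add: M.AB_basis_def)
  have inj: "inj \<phi>" using bij by (rule bij_is_inj)
  have "N.independent (\<phi> ` ?S)"
    using P.linear_independent_injective_image[OF L.linear_axioms B(2) inj_on_subset[OF inj subset_UNIV]] .
  moreover have "N.span (\<phi> ` ?S) = UNIV"
    using L.span_image[of ?S] B(3) bij_is_surj[OF bij] by simp
  moreover have "inj_on (\<phi> \<circ> v) {0..int d}"
    using B(1) inj by (auto intro: comp_inj_on inj_on_subset)
  ultimately show ?thesis
    using AB B(4,5)
    by (simp add: M.AB_basis_def N.AB_basis_def image_comp hom[symmetric] scal add L.zero L.diff)
qed

end

theory Submission
  imports Defs
begin

text \<open>
  The element \<open>\<Omega> = x\<^sup>2 + y\<^sup>2 + z\<^sup>2\<close> is central and acts on a module of type \<open>AB(d,n)\<close> as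
  \<open>(2d+1)(2d+3)\<close>. If \<open>(a,b,c)\<close> is a cyclic permutation of \<open>(x,y,z)\<close> and \<open>t = \<plusminus>1\<close>, then \<open>b + t c\<close>
  maps the \<open>\<theta>\<close>-eigenspace of \<open>a\<close> to the \<open>(2t-\<theta>)\<close>-eigenspace, and \<open>(b + t c)\<^sup>2 = \<Omega> - a\<^sup>2 + 2ta\<close>.
  Each generator has an explicit eigenvector for an eigenvalue of absolute value \<open>2d+1\<close>; applying
  the operators \<open>b + t c\<close> to it with alternating \<open>t\<close> yields eigenvectors for \<open>d+1\<close> distinct
  eigenvalues, which is the dimension of the module.
\<close>

section \<open>Ring identities from the anticommutator relations\<close>

text \<open>The mixed terms collect to t(bc + cb) = 2ta. The sum of squares is kept visible so that
  a scalar can replace it later; \<open>t\<close> stands for the image of a scalar sign.\<close>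

lemma anticommutator_square:
  fixes a b c t :: "'r::ring_1"
  assumes "b * c + c * b = 2 * a" "t * t = 1" "t * c = c * t" "t * b = b * t"
  shows "(b + t * c) * (b + t * c) = (a * a + b * b + c * c) - a * a + 2 * (t * a)"
proof -
  have "(b + t * c) * (b + t * c) = b * b + t * (b * c + c * b) + t * t * (c * c)"
    using assms(3,4) by (simp add: algebra_simps) (metis mult.assoc)
  also have "\<dots> = b * b + c * c + 2 * (t * a)"
    unfolding assms(1,2) by (simp add: algebra_simps mult_2 mult_2_right)
  finally show ?thesis by simp
qed

text \<open>The anticommutator of \<open>a\<close> with b + tc is 2c + 2tb, and t^2 = 1 turns this
  into 2t(b + tc).\<close>

lemma anticommutator_ladder:
  fixes a b c t :: "'r::ring_1"
  assumes "a * b + b * a = 2 * c" "c * a + a * c = 2 * b"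
    and "t * t = 1" "t * a = a * t"
  shows "a * (b + t * c) = 2 * t * (b + t * c) - (b + t * c) * a"
proof -
  have "a * (b + t * c) + (b + t * c) * a = (a * b + b * a) + t * (c * a + a * c)"
    using assms(4) by (simp add: algebra_simps) (metis mult.assoc)
  also have "\<dots> = 2 * (t * t * c) + 2 * (t * b)"
    unfolding assms(1-3) by (simp add: algebra_simps mult_2 mult_2_right)
  also have "\<dots> = 2 * t * (b + t * c)"
    by (simp add: algebra_simps)
  finally show ?thesis by (simp add: eq_diff_eq)
qed

text \<open>Since [p^2, q] = [p, pq + qp], the squares of \<open>a\<close> and \<open>c\<close>
  contribute 2[a, c] and 2[c, a], which cancel. Rotating the roles of the variables covers the other
  generators.\<close>

lemma sum_squares_commute:
  fixes a b c :: "'r::ring_1"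
  assumes "a * b + b * a = 2 * c" "b * c + c * b = 2 * a"
  shows "(a * a + b * b + c * c) * b = b * (a * a + b * b + c * c)"
proof -
  have sq: "p * p * q - q * (p * p) = p * (p * q + q * p) - (p * q + q * p) * p" for p q :: 'r
    by (simp add: algebra_simps)
  have "a * a * b - b * (a * a) = 2 * (a * c) - 2 * (c * a)"
    unfolding sq assms(1) by (simp add: algebra_simps mult_2 mult_2_right)
  moreover have "c * c * b - b * (c * c) = 2 * (c * a) - 2 * (a * c)"
    unfolding sq using assms(2) by (simp add: algebra_simps mult_2 mult_2_right)
  ultimately have "(a * a * b - b * (a * a)) + (c * c * b - b * (c * c)) = 0"
    by simp
  then show ?thesis by (simp add: algebra_simps)
qed

section \<open>Independence of eigenvectors and the dimension count\<close>

context vector_space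
begin

text \<open>The map f - b kills \<open>e b\<close> and multiplies \<open>x\<close> by c - b, so (c -
  b)x lies in the span over \<open>T\<close>, where the induction hypothesis makes it zero.\<close>

lemma eigenvector_in_span_eq_0:
  assumes f: "Vector_Spaces.linear scale scale f" and "finite S"
    and "\<And>c. c \<in> S \<Longrightarrow> f (e c) = scale c (e c)"
    and "c \<notin> S" "x \<in> span (e ` S)" "f x = scale c x"
  shows "x = 0"
  using assms(2-)
proof (induction S arbitrary: x)
  case empty
  then show ?case by simp
next
  case (insert b T)
  interpret f: Vector_Spaces.linear scale scale f by (rule f)
  have "f ` span (e ` T) = span (f ` e ` T)"
    by (simp add: f.span_image)
  also have "\<dots> \<subseteq> span (e ` T)"
    using insert.prems(1) by (intro span_minimal) (auto intro!: span_scale[OF span_base[OF imageI]])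
  finally have inv: "f y \<in> span (e ` T)" if "y \<in> span (e ` T)" for y
    using that by auto
  obtain k where k: "x - scale k (e b) \<in> span (e ` T)"
    using insert.prems(3) by (auto simp: span_insert)
  define y where "y = x - scale k (e b)"
  have "f y - scale b y = scale (c - b) x"
    using insert.prems(1)[of b] insert.prems(4)
    by (simp add: y_def f.diff f.scale algebra_simps)
  then have "scale (c - b) x \<in> span (e ` T)"
    using k inv[of y] by (metis span_diff span_scale y_def)
  then have "scale (c - b) x = 0"
    using insert.prems by (intro insert.IH) (auto simp: f.scale mult.commute)
  then show ?case using insert.prems(2) by simp
qed

lemma independent_eigenvectors:
  assumes f: "Vector_Spaces.linear scale scale f" and "finite S"
    and "\<And>c. c \<in> S \<Longrightarrow> e c \<noteq> 0 \<and> f (e c) = scale c (e c)"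
  shows "inj_on e S \<and> independent (e ` S)"
  using assms(2-)
proof (induction S)
  case empty
  then show ?case by (simp add: independent_empty)
next
  case (insert b T)
  have "e b \<notin> span (e ` T)"
    using eigenvector_in_span_eq_0[OF f, of T e b "e b"] insert by auto
  then show ?case
    using insert by (auto simp: independent_insert intro: span_base)
qed

text \<open>The spanning set \<open>B\<close> bounds every independent set by \<open>card S\<close>.
  Eigenvectors for \<open>S\<close> reach this bound, leaving no room for a vector outside their
  span or for a further eigenvalue.\<close>

lemma diagonalizable_if_enough_eigenvalues:
  assumes f: "Vector_Spaces.linear scale scale f"
    and S: "finite S" "\<And>c. c \<in> S \<Longrightarrow> eigenvalue f c"
    and B: "finite B" "span B = UNIV" "card B = card S"
  shows "diagonalizable f \<and> {c. eigenvalue f c} = S"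
proof
  define e where "e c = (SOME v. v \<noteq> 0 \<and> f v = scale c v)" for c
  have e: "e c \<noteq> 0 \<and> f (e c) = scale c (e c)" if "eigenvalue f c" for c
    using that unfolding eigenvalue_def e_def by (rule someI_ex)
  have ind: "inj_on e T \<and> independent (e ` T)" if "finite T" "\<forall>c\<in>T. eigenvalue f c" for T
    using independent_eigenvectors[OF f that(1)] that(2) e by blast
  have bound: "card T \<le> card S" if "independent T" for T
    using independent_span_bound[OF B(1) that] B(2,3) by simp
  note E = ind[OF S(1)]
  have "span (e ` S) = UNIV"
  proof (rule ccontr)
    assume "span (e ` S) \<noteq> UNIV"
    then obtain v where v: "v \<notin> span (e ` S)" by auto
    then have "independent (insert v (e ` S))"
      using E S(2) by (auto simp: independent_insert)
    from bound[OF this] v E S show False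
      by (auto simp: card_image span_base card_insert_if split: if_splits)
  qed
  with E S(2) e show "diagonalizable f"
    unfolding diagonalizable_def by (intro exI[of _ "e ` S"]) auto
  show "{c. eigenvalue f c} = S"
  proof (rule ccontr)
    assume "{c. eigenvalue f c} \<noteq> S"
    with S(2) obtain c where c: "eigenvalue f c" "c \<notin> S" by auto
    have "inj_on e (insert c S) \<and> independent (e ` insert c S)"
      using c S by (intro ind) auto
    with bound[of "e ` insert c S"] c S(1) show False
      by (auto simp: card_image simp del: image_insert)
  qed
qed

end

section \<open>Chains of eigenvectors of a generator\<close>

context alg_A_module
begin

lemma act_scal: "act r (scal c v) = scal c (act r v)"
  by (metis act_mult alg_scalar_central scal_def)

lemma linear_act: "Vector_Spaces.linear scal scal (act r)"
  by unfold_locales (simp_all add: act_add_right act_scal)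

lemma act_diff_left: "act (r - s) v = act r v - act s v"
  using act_add_left[of "r - s" s v] by (simp add: eq_diff_eq)

lemma act_2: "act 2 v = scal 2 v"
  using act_add_left[of 1 1 v] scale_left_distrib[of 1 1 v] by (simp add: act_one)

lemma act_eq_scal_mult:
  "act r v = scal p v \<Longrightarrow> act s v = scal q v \<Longrightarrow> act (r * s) v = scal (p * q) v"
  by (simp add: act_mult act_scal mult.commute)

text \<open>The operator \<open>b + t c\<close> with \<open>t = s (-1)\<^sup>i\<close> maps the \<open>i\<close>-th eigenvector to the next one. Its
  square acts on the \<open>i\<close>-th eigenvector as \<open>(2d+2)\<^sup>2 - (2d-2i)\<^sup>2\<close>, so the chain does not
  break off before \<open>i = d\<close>.\<close>

lemma eigenvalue_chain:
  fixes a b c :: "'k alg_A" and s :: int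
  assumes rel: "a * b + b * a = 2 * c" "b * c + c * b = 2 * a" "c * a + a * c = 2 * b"
    and cas: "\<And>v. act (a * a + b * b + c * c) v = scal (of_int ((2 * int d + 1) * (2 * int d + 3))) v"
    and s: "s * s = 1"
    and top: "eigenvalue (act a) (of_int (s * (2 * int d + 1)))"
    and char_0: "inj (of_int :: int \<Rightarrow> 'k)"
    and "i \<le> d"
  shows "eigenvalue (act a) (of_int (s * (- 1) ^ i * (2 * int d - 2 * int i + 1)))"
  using \<open>i \<le> d\<close>
proof (induction i)
  case 0
  then show ?case using top by simp
next
  case (Suc i)
  define m where "m = 2 * int d - 2 * int i + 1"
  \<comment> \<open>As m > 0, \<tau> is the sign of the current eigenvalue \<tau>m. With t = \<tau>
    the next eigenvalue is -\<tau>(m - 2): the sign flips and the absolute value drops by 2.\<close>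
  define \<tau> where "\<tau> = s * (- 1) ^ i"
  have \<tau>: "\<tau> * \<tau> = 1"
    using s by (cases "even i") (simp_all add: \<tau>_def)
  define t :: "'k alg_A" where "t = alg_scalar (of_int \<tau>)"
  have t: "t * t = 1" "\<And>r. t * r = r * t"
    unfolding t_def
    by (simp add: alg_scalar_one \<tau> flip: alg_scalar_mult of_int_mult) (rule alg_scalar_central)
  from Suc obtain u where u: "u \<noteq> 0" "act a u = scal (of_int (\<tau> * m)) u"
    by (auto simp: eigenvalue_def m_def \<tau>_def)
  define w where "w = act (b + t * c) u"
  have act_t: "act t v = scal (of_int \<tau>) v" for v
    by (simp add: t_def scal_def)
  have "act (b + t * c) w = act ((a * a + b * b + c * c) - a * a + 2 * (t * a)) u"
    unfolding w_def act_mult[symmetric]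
    using anticommutator_square[OF rel(2) t(1) t(2) t(2)] by simp
  also have "\<dots> = scal (of_int ((2 * int d + 1) * (2 * int d + 3))) u
      - scal (of_int (\<tau> * m) * of_int (\<tau> * m)) u + scal (2 * of_int (\<tau> * (\<tau> * m))) u"
    unfolding act_add_left[of "_ - _"] act_diff_left cas act_eq_scal_mult[OF u(2) u(2)]
    by (simp add: act_mult u(2) act_t act_2)
  also have "\<dots> = scal (of_int ((2 * int d + 1) * (2 * int d + 3)
      - (\<tau> * \<tau>) * (m * m) + 2 * (\<tau> * \<tau>) * m)) u"
    unfolding scale_left_diff_distrib[symmetric] scale_left_distrib[symmetric]
    by (simp add: mult_ac)
  also have "(2 * int d + 1) * (2 * int d + 3) - (\<tau> * \<tau>) * (m * m) + 2 * (\<tau> * \<tau>) * m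
      = (2 * int i + 2) * (4 * int d + 2 - 2 * int i)"
    unfolding \<tau> by (simp add: m_def algebra_simps)
  finally have sq: "act (b + t * c) w = scal (of_int ((2 * int i + 2) * (4 * int d + 2 - 2 * int i))) u" .
  have "(2 * int i + 2) * (4 * int d + 2 - 2 * int i) \<noteq> 0"
    using Suc.prems by simp
  then have "(of_int ((2 * int i + 2) * (4 * int d + 2 - 2 * int i)) :: 'k) \<noteq> 0"
    using injD[OF char_0, of _ 0] by (metis of_int_0)
  with u(1) have "act (b + t * c) w \<noteq> 0" unfolding sq by simp
  then have "w \<noteq> 0"
    using act_add_right[of "b + t * c" 0 0] by auto
  have "act a w = act (2 * t * (b + t * c) - (b + t * c) * a) u"
    unfolding w_def act_mult[symmetric]
    using anticommutator_ladder[OF rel(1,3) t(1) t(2)] by simp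
  also have "\<dots> = scal (of_int (2 * \<tau> - \<tau> * m)) w"
    by (simp add: act_diff_left act_mult u(2) act_t act_2 act_scal scale_left_diff_distrib
        flip: w_def)
  also have "2 * \<tau> - \<tau> * m = s * (- 1) ^ Suc i * (2 * int d - 2 * int (Suc i) + 1)"
    by (simp add: \<tau>_def m_def algebra_simps)
  finally show ?case using \<open>w \<noteq> 0\<close> unfolding eigenvalue_def by blast
qed

text \<open>The hypothesis describes half of the \<open>sl\<^sub>2\<close> action of \<open>E + F\<close> on binary forms of degree
  \<open>2d+1\<close>, folded along the symmetry \<open>j \<mapsto> 2d+1-j\<close> of the weight basis. The vector is the image of
  the extreme eigenvector \<open>(X + Y)\<^bsup>2d+1\<^esup>\<close>.\<close>

lemma act_sum_folded:
  fixes w :: "int \<Rightarrow> 'v"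
  assumes w: "w (- 1) = 0" "w (int d + 1) = w (int d)"
    and r: "\<And>i. i \<le> d \<Longrightarrow> act r (w (int i)) =
      scal k (scal (of_int (2 * int d - int i + 2)) (w (int i - 1)) + scal (of_int (int i + 1)) (w (int i + 1)))"
  shows "act r (\<Sum>i\<le>d. w (int i)) = scal (k * of_int (2 * int d + 1)) (\<Sum>i\<le>d. w (int i))"
proof -
  interpret L: Vector_Spaces.linear scal scal "act r" by (rule linear_act)
  \<comment> \<open>An inner \<open>w i\<close> collects i from below and 2d - i + 1 from above, in
    total 2d + 1. The two boundary terms remain; at j = d both have coefficient d + 1 and cancel by
    \<open>w (d + 1) = w d\<close>.\<close>
  have partial: "act r (\<Sum>i\<le>j. w (int i)) = scal k (scal (of_int (2 * int d + 1)) (\<Sum>i\<le>j. w (int i))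
      + scal (of_int (int j + 1)) (w (int j + 1)) - scal (of_int (2 * int d - int j + 1)) (w (int j)))"
    if "j \<le> d" for j
    using that
  proof (induction j)
    case 0
    then show ?case using r[of 0] w(1) by simp
  next
    case (Suc j)
    have next_term: "act r (w (1 + int j)) =
        scal k (scal (of_int (2 * int d - int j + 1)) (w (int j)) + scal (of_int (int j + 2)) (w (int j + 2)))"
      using r[of "Suc j"] Suc.prems by (simp add: algebra_simps)
    have step: "act r (\<Sum>i\<le>Suc j. w (int i)) = act r (\<Sum>i\<le>j. w (int i)) + act r (w (1 + int j))"
      by (simp add: L.add)
    show ?case
      unfolding step Suc.IH[OF Suc_leD[OF Suc.prems]] next_term by (simp add: algebra_simps)
  qed
  show ?thesis
    using partial[of d] w(2) by (simp add: algebra_simps)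
qed

section \<open>The explicit basis of type AB\<close>

text \<open>The vectors on which \<Omega> acts as the scalar form a subspace stable under y and z,
  because \<Omega> commutes with both. It contains \<open>v 0\<close>, and y and z generate the
  remaining basis vectors from there.\<close>

lemma AB_casimir:
  assumes AB: "AB_basis d n v" and char_0: "inj (of_int :: int \<Rightarrow> 'k)"
  shows "act (alg_gen GenX * alg_gen GenX + alg_gen GenY * alg_gen GenY + alg_gen GenZ * alg_gen GenZ) w
    = scal (of_int ((2 * int d + 1) * (2 * int d + 3))) w"
proof -
  define X Y Z :: "'k alg_A" where "X = alg_gen GenX" and "Y = alg_gen GenY" and "Z = alg_gen GenZ"
  define C :: 'k where "C = of_int ((2 * int d + 1) * (2 * int d + 3))"
  define \<Omega> where "\<Omega> = X * X + Y * Y + Z * Z"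
  define \<epsilon> :: int where "\<epsilon> = (- 1) ^ d"
  define \<sigma> where "\<sigma> = gen_sign n"
  note rel = alg_A_relations[where ?'k = 'k, folded X_def Y_def Z_def]
  have \<epsilon>: "\<epsilon> * \<epsilon> = 1" by (cases "even d") (simp_all add: \<epsilon>_def)
  have \<sigma>: "\<sigma> a * \<sigma> a = 1" "\<sigma> GenY * \<sigma> GenZ = \<sigma> GenX" for a
    by (cases n; simp add: \<sigma>_def gen_sign_def)+
  have v: "v (- 1) = 0" "span (v ` {0..int d}) = UNIV"
    using AB by (simp_all add: AB_basis_def)
  have vY: "act Y (v (int i)) = scal (of_int (\<sigma> GenY * \<epsilon>))
      (scal (of_int (2 * int d - int i + 2)) (v (int i - 1)) + scal (of_int (int i + 1)) (v (int i + 1)))"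
    and vZ: "act Z (v (int i)) = scal (of_int (\<sigma> GenZ))
      (scal (of_int ((- 1) ^ (i + 1) * (2 * int d - int i + 2))) (v (int i - 1))
        + scal (of_int ((- 1) ^ i * (int i + 1))) (v (int i + 1)))"
    if "i \<le> d" for i
    using AB that unfolding AB_basis_def X_def Y_def Z_def \<epsilon>_def \<sigma>_def by blast+
  let ?good = "\<lambda>w. act \<Omega> w = scal C w"
  have comm: "\<Omega> * Y = Y * \<Omega>" "\<Omega> * Z = Z * \<Omega>"
    using sum_squares_commute[OF rel(1,2)] sum_squares_commute[OF rel(2,3)]
    by (simp_all add: \<Omega>_def add_ac)
  have good_YZ: "?good (act Y w) \<and> ?good (act Z w)" if "?good w" for w
    using that comm by (metis act_mult act_scal)
  have good_add: "?good (w + w')" if "?good w" "?good w'" for w w'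
    using that by (simp add: act_add_right scale_right_distrib)
  have good_scal: "?good (scal k w)" if "?good w" for k w
    using that by (simp add: act_scal mult.commute)

  have "?good (v (int i))" if "i \<le> d" for i
    using that
  proof (induction i)
    case 0
    \<comment> \<open>This sign is opposite to that of the eigenvalue of x on \<open>v 0\<close>;
      for it y + tz annihilates \<open>v 0\<close>, so the square formula gives \<Omega> on
      \<open>v 0\<close> as x^2 - 2tx.\<close>
    define \<tau> where "\<tau> = - (\<sigma> GenX * \<epsilon>)"
    define t :: "'k alg_A" where "t = alg_scalar (of_int \<tau>)"
    have \<tau>: "\<tau> * \<tau> = 1" "\<tau> = - (\<sigma> GenY * \<sigma> GenZ * \<epsilon>)"
      using \<epsilon> \<sigma>(1)[of GenX] by (simp_all add: \<tau>_def \<sigma>(2) algebra_simps)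
    have t: "t * t = 1" "\<And>r. t * r = r * t"
      unfolding t_def
      by (simp add: alg_scalar_one \<tau>(1) flip: alg_scalar_mult of_int_mult) (rule alg_scalar_central)
    have act_t: "act t v = scal (of_int \<tau>) v" for v
      by (simp add: t_def scal_def)
    have vX: "act X (v 0) = scal (of_int (- \<tau> * (2 * int d + 1))) (v 0)"
      using AB by (auto simp: AB_basis_def X_def \<tau>_def \<sigma>_def \<epsilon>_def dest!: spec[of _ 0])
    have "act (Y + t * Z) (v 0) = scal (of_int (\<sigma> GenY * \<epsilon> + \<tau> * \<sigma> GenZ)) (v 1)"
      using vY[of 0] vZ[of 0] v(1)
      by (simp add: act_add_left act_mult act_t scale_left_distrib)
    also have "\<sigma> GenY * \<epsilon> + \<tau> * \<sigma> GenZ = 0"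
      using \<sigma>(1)[of GenZ] by (simp add: \<tau>(2))
    finally have "act (Y + t * Z) (v 0) = 0" by simp
    then have "act ((Y + t * Z) * (Y + t * Z)) (v 0) = 0"
      using act_add_right[of "Y + t * Z" 0 0] by (simp add: act_mult)
    then have "act (\<Omega> - X * X + 2 * (t * X)) (v 0) = 0"
      unfolding anticommutator_square[OF rel(2) t(1) t(2) t(2)] \<Omega>_def .
    then have "act \<Omega> (v 0) = act (X * X) (v 0) - act (2 * (t * X)) (v 0)"
      unfolding act_add_left[of "_ - _"] act_diff_left by (simp add: algebra_simps)
    also have "\<dots> = scal (of_int ((- \<tau> * (2 * int d + 1)) * (- \<tau> * (2 * int d + 1))
        - 2 * (\<tau> * (- \<tau> * (2 * int d + 1))))) (v 0)"
      unfolding act_eq_scal_mult[OF vX vX]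
      by (simp add: act_mult vX act_t act_2 scale_left_distrib)
    also have "(- \<tau> * (2 * int d + 1)) * (- \<tau> * (2 * int d + 1)) - 2 * (\<tau> * (- \<tau> * (2 * int d + 1)))
        = (\<tau> * \<tau>) * ((2 * int d + 1) * (2 * int d + 3))"
      by (simp add: algebra_simps)
    finally show ?case by (simp add: \<tau>(1) C_def)
  next
    case (Suc i)
    \<comment> \<open>These signs make the \<open>v (i - 1)\<close> terms of py and qz cancel and
      the \<open>v (i + 1)\<close> terms agree, leaving 2(i + 1) times the next basis vector.
      Characteristic zero allows this factor to be cancelled.\<close>
    define p q where "p = \<sigma> GenY * \<epsilon>" and "q = \<sigma> GenZ * (- 1) ^ i"
    have p: "p * (\<sigma> GenY * \<epsilon>) = 1" and q: "q * \<sigma> GenZ * (- 1) ^ i = 1"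
      "q * \<sigma> GenZ * (- 1) ^ (i + 1) = - 1"
      by (cases "even d"; cases "even i"; simp add: p_def q_def \<sigma>_def \<epsilon>_def gen_sign_def)+
    have act_Y: "scal (of_int p) (act Y (v (int i)))
        = scal (of_int (2 * int d - int i + 2)) (v (int i - 1)) + scal (of_int (int i + 1)) (v (int i + 1))"
      using Suc.prems by (simp only: vY Suc_leD scale_scale p of_int_1 scale_one flip: of_int_mult)
    have act_Z: "scal (of_int q) (act Z (v (int i)))
        = scal (of_int (- 1 * (2 * int d - int i + 2))) (v (int i - 1)) + scal (of_int (1 * (int i + 1))) (v (int i + 1))"
      using Suc.prems
      by (simp only: vZ Suc_leD scale_right_distrib scale_scale q flip: of_int_mult mult.assoc)
    have cancel: "(scal (of_int A) x + scal (of_int B) y) + (scal (of_int (- 1 * A)) x + scal (of_int (1 * B)) y)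
        = scal (of_int (2 * B)) y" for A B x y
      by (simp only: mult_2 of_int_add scale_left_distrib) simp
    have "int (Suc i) = int i + 1" by simp
    then have "scal (of_int p) (act Y (v (int i))) + scal (of_int q) (act Z (v (int i)))
      = scal (of_int (2 * int (Suc i))) (v (int (Suc i)))"
      unfolding act_Y act_Z cancel by (simp only:)
    moreover have "?good (scal (of_int p) (act Y (v (int i))) + scal (of_int q) (act Z (v (int i))))"
      using Suc good_YZ by (intro good_add good_scal) auto
    ultimately have "?good (scal (of_int (2 * int (Suc i))) (v (int (Suc i))))" by simp
    then have "scal (of_int (2 * int (Suc i))) (act \<Omega> (v (int (Suc i)))) =
        scal (of_int (2 * int (Suc i))) (scal C (v (int (Suc i))))"
      by (simp only: act_scal scale_left_commute)
    moreover have "(of_int (2 * int (Suc i)) :: 'k) \<noteq> of_int 0"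
      using injD[OF char_0] by fastforce
    ultimately show ?case by (simp only: scale_cancel_left of_int_0) simp
  qed
  then have "v ` {0..int d} \<subseteq> {w. ?good w}"
    by (auto elim!: nonneg_int_cases)
  moreover have "subspace {w. ?good w}"
    using good_add good_scal act_add_right[of \<Omega> 0 0] by (simp add: subspace_def)
  ultimately have "?good w"
    using span_minimal v(2) by blast
  then show ?thesis by (simp add: \<Omega>_def C_def X_def Y_def Z_def)
qed

lemma AB_combination_nonzero:
  assumes AB: "AB_basis d n v" and "s 0 \<noteq> 0"
  shows "(\<Sum>i\<le>d. scal (s i) (v (int i))) \<noteq> 0"
proof
  assume 0: "(\<Sum>i\<le>d. scal (s i) (v (int i))) = 0"
  let ?I = "{0..int d}"
  have v: "inj_on v ?I" "independent (v ` ?I)"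
    using AB by (simp_all add: AB_basis_def)
  \<comment> \<open>\<open>independentD\<close> takes coefficients indexed by vectors; injectivity
    of \<open>v\<close> on the index range recovers the index.\<close>
  let ?u = "\<lambda>b. s (nat (inv_into ?I v b))"
  have "(\<Sum>b\<in>v ` ?I. scal (?u b) b) = (\<Sum>j\<in>?I. scal (s (nat j)) (v j))"
    using v(1) by (simp add: sum.reindex)
  also have "\<dots> = (\<Sum>i\<le>d. scal (s i) (v (int i)))"
    by (rule sum.reindex_bij_witness[of _ int nat]) auto
  finally have "?u (v 0) = 0"
    using 0 by (intro independentD[OF v(2)]) auto
  with v(1) \<open>s 0 \<noteq> 0\<close> show False by simp
qed

text \<open>The eigenvectors are \<open>v 0\<close> for x, the sum of the basis for y, and a signed
  sum of the basis for z.\<close>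

lemma AB_top_eigenvalue:
  assumes AB: "AB_basis d n v"
  shows "eigenvalue (act (alg_gen a)) (of_int (gen_sign n a * (- 1) ^ d * (2 * int d + 1)))"
proof (cases a)
  case GenX
  have "v 0 \<noteq> 0"
    using AB dependent_zero[of "v ` {0..int d}"] by (force simp: AB_basis_def)
  moreover have "act (alg_gen GenX) (v 0) = scal (of_int (gen_sign n GenX * (- 1) ^ d * (2 * int d + 1))) (v 0)"
    using AB by (auto simp: AB_basis_def dest!: spec[of _ 0])
  ultimately show ?thesis
    unfolding eigenvalue_def GenX by blast
next
  case GenY
  have "act (alg_gen GenY) (\<Sum>i\<le>d. v (int i))
      = scal (of_int (gen_sign n GenY * (- 1) ^ d) * of_int (2 * int d + 1)) (\<Sum>i\<le>d. v (int i))"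
    using AB by (intro act_sum_folded) (auto simp: AB_basis_def)
  moreover have "(\<Sum>i\<le>d. v (int i)) \<noteq> 0"
    using AB_combination_nonzero[OF AB, of "\<lambda>_. 1"] by simp
  ultimately show ?thesis
    unfolding eigenvalue_def GenY of_int_mult by blast
next
  case GenZ
  \<comment> \<open>The rescaling \<open>v\<^sub>i \<mapsto> s\<^sub>i v\<^sub>i\<close> makes \<open>z\<close> act as \<open>y\<close> does, up to the overall sign.\<close>
  define s :: "nat \<Rightarrow> int" where "s i = (\<Prod>j<i. (- 1) ^ (d + j))" for i
  have s_Suc: "s (Suc i) = (- 1) ^ (d + i) * s i" for i
    by (simp add: s_def)
  define w where "w j = scal (of_int (s (nat j))) (v j)" for j
  \<comment> \<open>The offset d in the exponents gives s(d + 1) = (-1)^(2d) s(d) = s(d), so the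
    folding condition survives the rescaling. At -1 the truncation by \<open>nat\<close> is harmless
    because \<open>v (- 1) = 0\<close>.\<close>
  have w: "w (- 1) = 0" "w (int d + 1) = w (int d)"
    using AB s_Suc[of d] by (simp_all add: w_def AB_basis_def nat_add_distrib)
  have "act (alg_gen GenZ) (\<Sum>i\<le>d. w (int i))
      = scal (of_int (gen_sign n GenZ * (- 1) ^ d) * of_int (2 * int d + 1)) (\<Sum>i\<le>d. w (int i))"
  proof (intro act_sum_folded w)
    fix i assume i: "i \<le> d"
    have up: "s i * (- 1) ^ i = (- 1) ^ d * s (Suc i)"
      by (cases "even d"; cases "even i") (simp_all add: s_Suc)
    have down: "s i * (- 1) ^ (i + 1) = (- 1) ^ d * s (i - 1)" if "i > 0"
      using that s_Suc[of "i - 1"] by (cases "even d"; cases "even i") simp_all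
    have "act (alg_gen GenZ) (w (int i)) = scal (of_int (gen_sign n GenZ))
       (scal (of_int (s i * (- 1) ^ (i + 1) * (2 * int d - int i + 2))) (v (int i - 1))
        + scal (of_int (s i * (- 1) ^ i * (int i + 1))) (v (int i + 1)))"
      using AB i
      by (simp only: AB_basis_def w_def act_scal scale_right_distrib scale_scale nat_int mult_ac flip: of_int_mult)
    also have "scal (of_int (s i * (- 1) ^ (i + 1) * (2 * int d - int i + 2))) (v (int i - 1))
      = scal (of_int ((- 1) ^ d)) (scal (of_int (2 * int d - int i + 2)) (w (int i - 1)))"
    proof (cases i)
      case 0
      then show ?thesis using w(1) AB by (simp add: AB_basis_def)
    next
      case (Suc k)
      then have "nat (int i - 1) = i - 1" "i > 0" by simp_all
      then show ?thesis
        unfolding w_def by (simp only: down scale_scale mult_ac flip: of_int_mult)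
    qed
    also have "scal (of_int (s i * (- 1) ^ i * (int i + 1))) (v (int i + 1))
      = scal (of_int ((- 1) ^ d)) (scal (of_int (int i + 1)) (w (int i + 1)))"
    proof -
      have "nat (int i + 1) = Suc i" by simp
      then show ?thesis
        unfolding w_def by (simp only: up scale_scale mult_ac flip: of_int_mult)
    qed
    finally show "act (alg_gen GenZ) (w (int i)) = scal (of_int (gen_sign n GenZ * (- 1) ^ d))
       (scal (of_int (2 * int d - int i + 2)) (w (int i - 1)) + scal (of_int (int i + 1)) (w (int i + 1)))"
      by (simp add: scale_right_distrib mult.assoc)
  qed
  moreover have "(\<Sum>i\<le>d. w (int i)) \<noteq> 0"
    using AB_combination_nonzero[OF AB, of "\<lambda>i. of_int (s i)"] by (simp add: w_def s_def)
  ultimately show ?thesis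
    unfolding eigenvalue_def GenZ of_int_mult by blast
qed

text \<open>The relations and \<Omega> are invariant under cyclic rotation, so the chain can start
  from any generator, with initial sign \<open>gen_sign n a * (- 1) ^ d\<close>.\<close>

lemma AB_eigenvalue:
  assumes AB: "AB_basis d n v" and char_0: "inj (of_int :: int \<Rightarrow> 'k)" and "i \<le> d"
  shows "eigenvalue (act (alg_gen a)) (of_int (gen_sign n a * ((- 1) ^ (d + i) * (2 * int d - 2 * int i + 1))))"
proof -
  note rel = alg_A_relations[where ?'k = 'k] and cas = AB_casimir[OF AB char_0]
  have sign: "gen_sign n a * (- 1) ^ d * (gen_sign n a * (- 1) ^ d) = 1"
    by (cases "even d") (simp_all add: gen_sign_def)
  note chain = eigenvalue_chain[OF _ _ _ _ sign AB_top_eigenvalue[OF AB] char_0 \<open>i \<le> d\<close>]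
  have "eigenvalue (act (alg_gen a)) (of_int (gen_sign n a * (- 1) ^ d * (- 1) ^ i * (2 * int d - 2 * int i + 1)))"
  proof (cases a)
    case GenX
    show ?thesis
      by (rule chain[of "alg_gen GenY" "alg_gen GenZ"]; unfold GenX; fact rel cas)
  next
    case GenY
    show ?thesis
      by (rule chain[of "alg_gen GenZ" "alg_gen GenX"]; unfold GenY; (fact rel | simp add: cas[simplified add_ac] add_ac))
  next
    case GenZ
    show ?thesis
      by (rule chain[of "alg_gen GenX" "alg_gen GenY"]; unfold GenZ; (fact rel | simp add: cas[simplified add_ac] add_ac))
  qed
  then show ?thesis by (simp add: power_add mult.assoc)
qed

end

theorem proposition5p3:
  fixes act :: "'k::{alg_closed_field,field_char_0} alg_A \<Rightarrow> 'v::ab_group_add \<Rightarrow> 'v"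
    and n :: gen and d :: nat
  assumes "alg_A_module act"
    and "alg_A_module.finite_dimensional act"
    and "left_module.irreducible act"
    and "alg_A_module.type_AB act d n"
  shows "(\<forall>a. vector_space.diagonalizable (alg_A_module.scal act) (act (alg_gen a))) \<and>
    (\<forall>a. {c. vector_space.eigenvalue (alg_A_module.scal act) (act (alg_gen a)) c} =
      (if a = n
       then {of_int ((- 1) ^ (d + i) * (2 * int d - 2 * int i + 1)) | i. i \<le> d}
       else {of_int ((- 1) ^ (d + i + 1) * (2 * int d - 2 * int i + 1)) | i. i \<le> d}))"
proof -
  interpret alg_A_module act by (rule assms(1))
  obtain v where AB: "AB_basis d n v"
    using assms(4) by (auto simp: type_AB_def)
  \<comment> \<open>The locale works over an arbitrary field, so its lemmas receive characteristic
    zero in this form.\<close>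
  have char_0: "inj (of_int :: int \<Rightarrow> 'k)" by (simp add: inj_def)
  have B: "inj_on v {0..int d}" "span (v ` {0..int d}) = UNIV"
    using AB by (simp_all add: AB_basis_def)
  have *: "diagonalizable (act (alg_gen a)) \<and> {c. eigenvalue (act (alg_gen a)) c} =
      {of_int (gen_sign n a * ((- 1) ^ (d + i) * (2 * int d - 2 * int i + 1))) | i. i \<le> d}" (is "_ \<and> _ = ?S")
    for a
  proof -
    define \<mu> :: "nat \<Rightarrow> int" where "\<mu> i = gen_sign n a * ((- 1) ^ (d + i) * (2 * int d - 2 * int i + 1))" for i
    \<comment> \<open>The absolute values already differ, so the d + 1 eigenvalues are distinct
      whatever their signs.\<close>
    have "\<bar>\<mu> i\<bar> = 2 * int d - 2 * int i + 1" if "i \<le> d" for i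
      using that by (simp add: \<mu>_def abs_mult gen_sign_def power_abs)
    then have "inj_on (\<lambda>i. \<bar>\<mu> i\<bar>) {..d}"
      by (auto simp: inj_on_def)
    then have "inj_on \<mu> {..d}"
      by (auto simp: inj_on_def)
    then have "inj_on (\<lambda>i. of_int (\<mu> i) :: 'k) {..d}"
      by (auto simp: inj_on_def)
    moreover have S: "?S = (\<lambda>i. of_int (\<mu> i)) ` {..d}"
      by (auto simp: \<mu>_def)
    ultimately have "card ?S = d + 1" by (simp add: card_image)
    moreover have "card (v ` {0..int d}) = d + 1"
      using B(1) by (simp add: card_image)
    ultimately show ?thesis
      using AB_eigenvalue[OF AB char_0] B(2)
      by (intro diagonalizable_if_enough_eigenvalues[OF linear_act, where B = "v ` {0..int d}"])
        (auto simp: S \<mu>_def)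
  qed
  have "gen_sign n n = 1" "gen_sign n a = - 1" if "a \<noteq> n" for a
    using that by (auto simp: gen_sign_def)
  with * show ?thesis
    by (auto simp: gen_sign_def)
qed

end
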